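(* Let $\mathcal X,\mathcal Y$ be Hilbert spaces, let $E:\mathcal X\to\mathcal Y$ be a bounded linear operator and let $A:\mathcal D(A)\subseteq\mathcal X\to\mathcal Y$ be a closed, densely defined linear operator. Consider the operator pencil $\lambda E-A$ and the associated Cauchy problem $E\dot x(t)=Ax(t)$, $x(0)=x_0$. Let $\{a_k\}_{k=1}^\infty$ with $a_k\in\mathcal D(A)$ for all $k\ge 1$ be a nonzero sequence such that $$Ea_1=0,\qquad Ea_{k+1}=Aa_k,\quad k\ge 1,$$ and such that $\|a_k\|$, $\|Aa_k\|$, $\|Ea_k\|$ are bounded by $\left(\frac kc\right)^k$ for $k$ sufficiently large and some $c>0$. Then there exists a nonzero $\mathcal X$-valued analytic function $f(t)$, defined for $|t|<1/(ce)$ and satisfying $$f(t)\in\mathcal D(A),\qquad E\dot f(t)=Af(t),\qquad f(0)=0.$$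
   Context: The variable $t$ is real and $\dot f$ denotes the derivative of $f$ with respect to $t$. In the bound $1/(ce)$, $e$ is Euler's number. A nonzero sequence is one whose terms are not all zero.
   Formalization: The radius |t| < 1/(ce) is replaced by |t| < c/e, the radius matching the bound (k/c)^k; with 1/(ce) the claim fails for c < 1 (e.g. E the left shift on l2, A = diag(1,2,3,...), a_k = (k-1)! e_k, c = 1/10). *)

theory Defs
  imports "HOL-Analysis.Analysis"
begin

(* Hilbert spaces are types of sort {real_inner, complete_space}.  A complex Hilbert space is an
   instance of this by restriction of scalars, with inner product Re <x, y>: the norm and topology
   are unchanged, and complex-linear operators and subspaces are in particular real-linear. *)

(* An unbounded operator is a pair of a domain D and a total function A whose values outside D
   are irrelevant. *)
definition linear_operator_on :: "'x::real_vector set \<Rightarrow> ('x \<Rightarrow> 'y::real_vector) \<Rightarrow> bool" where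
  "linear_operator_on D A \<longleftrightarrow>
     subspace D \<and>
     (\<forall>x\<in>D. \<forall>y\<in>D. A (x + y) = A x + A y) \<and>
     (\<forall>r. \<forall>x\<in>D. A (r *\<^sub>R x) = r *\<^sub>R A x)"

definition densely_defined :: "'x::topological_space set \<Rightarrow> bool" where
  "densely_defined D \<longleftrightarrow> closure D = UNIV"

definition closed_operator ::
  "'x::topological_space set \<Rightarrow> ('x \<Rightarrow> 'y::topological_space) \<Rightarrow> bool" where
  "closed_operator D A \<longleftrightarrow> closed {(x, A x) | x. x \<in> D}"

(* Analyticity of a vector-valued function of a real variable; the library's analytic_on is only
   for complex functions. *)
definition real_analytic_on :: "(real \<Rightarrow> 'x::real_normed_vector) \<Rightarrow> real set \<Rightarrow> bool" where
  "real_analytic_on f S \<longleftrightarrow>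
     (\<forall>s\<in>S. \<exists>r>0. \<exists>b :: nat \<Rightarrow> 'x.
        \<forall>t. \<bar>t - s\<bar> < r \<longrightarrow> (\<lambda>n. (t - s) ^ n *\<^sub>R b n) sums f t)"

(* Radius.  If norm (a k) <= (k/c)^k then, by Stirling, norm (a k) / k! is at most about (e/c)^k, so
   the solution f t = (SUM k. t^k / k! a k) lives on |t| < c/e.  The radius is sometimes printed as
   1/(c e), which belongs to the bound (c k)^k.  With the bound (k/c)^k it cannot be used: for
   c >= 1 it is at most c/e, and for c < 1 the assertion with 1/(c e) fails.
   Counterexample: on l2 with basis e_1, e_2, ... let E be the left shift, A = diag(1, 2, 3, ...)
   with maximal domain and a k = (k-1)! e_k.  The growth bound holds for every c <= 1.  A solution
   has components f_1 = g and f_k t = (k-1) * integral over s in [0,t] of (t-s)^(k-2) g s, for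
   k >= 2; if g is analytic and not identically 0, these are unbounded in k for each t > 1, so no
   nonzero solution exists on |t| < 1/(c e) as soon as c < 1/e. *)

end

theory Submission
  imports Defs
begin

text \<open>
  The solution is the exponential generating function of the chain,
  \<open>f t = (\<Sum>k\<ge>1. t ^ k / k! a\<^sub>k)\<close>.  Differentiating it term by term shifts the chain by one
  index, and so does \<open>E a\<^sub>k\<^sub>+\<^sub>1 = A a\<^sub>k\<close>.  Since \<open>E\<close> is bounded, it acts term by term on the
  series of the derivative, where \<open>E a\<^sub>1 = 0\<close> removes the first term; what remains is
  \<open>\<Sum>k\<ge>1. t ^ k / k! A a\<^sub>k\<close>.  The operator \<open>A\<close> is unbounded, but it is closed: the partial
  sums of \<open>f t\<close> and their images under \<open>A\<close> both converge, so the limit point \<open>(f t, E (f' t))\<close>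
  lies on the graph of \<open>A\<close>, which gives at once \<open>f t \<in> D\<close> and \<open>A (f t) = E (f' t)\<close>.

  The radius comes from \<open>k ^ k / k! \<le> e ^ k\<close>, which turns the growth bound into domination of the
  series by a geometric series of ratio \<open>\<bar>t\<bar> e / c\<close>.

  Two facts on power series with coefficients in a Banach space carry the analytic part.  They can
  be expanded again around every interior point, by interchanging the sums in the
  binomial expansion of \<open>(s + h) ^ k\<close> (\<open>power_series_recentre\<close>), which yields analyticity and
  identifies the derivative as the linear coefficient of the new expansion
  (\<open>power_series_has_vector_derivative\<close>).  And a power series that vanishes near its centre has only
  zero coefficients (\<open>power_series_identity\<close>), so \<open>f \<noteq> 0\<close> because some \<open>a\<^sub>k \<noteq> 0\<close>.
\<close>

section \<open>Power series with coefficients in a Banach space\<close>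

text \<open>
  The sort \<open>{real_normed_vector, complete_space}\<close> does not entail the class \<open>banach\<close>, although
  the two describe the same spaces.  In this sort, to which Hilbert spaces belong, completeness is
  applied once, to conclude that absolute summability implies summability: a finite set \<open>F\<close>
  exhausting the sum of the norms to within \<open>\<epsilon> / 2\<close> makes the partial sums over all larger sets
  \<open>\<epsilon>\<close>-close to each other.
\<close>

lemma summable_on_if_norm_summable_on:
  fixes f :: "'i \<Rightarrow> 'a::{real_normed_vector, complete_space}"
  assumes "(\<lambda>i. norm (f i)) summable_on I"
  shows "f summable_on I"
proof -
  let ?fin = "finite_subsets_at_top I"
  have "\<exists>P. eventually P ?fin \<and> (\<forall>G H. P G \<and> P H \<longrightarrow> dist (sum f G) (sum f H) < \<epsilon>)"
    if "\<epsilon> > 0" for \<epsilon>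
  proof -
    \<comment> \<open>The approximation is non-strict, hence a third in order to stay strictly below a half.\<close>
    obtain F where F: "finite F" "F \<subseteq> I"
      and "dist (\<Sum>i\<in>F. norm (f i)) (\<Sum>\<^sub>\<infinity>i\<in>I. norm (f i)) \<le> \<epsilon> / 3"
      using infsum_finite_approximation[OF assms, of "\<epsilon> / 3"] \<open>\<epsilon> > 0\<close> by auto
    then have exhaust: "(\<Sum>\<^sub>\<infinity>i\<in>I. norm (f i)) - (\<Sum>i\<in>F. norm (f i)) < \<epsilon> / 2"
      using \<open>\<epsilon> > 0\<close> unfolding dist_real_def by linarith
    have close: "dist (sum f G) (sum f F) < \<epsilon> / 2" if G: "finite G" "F \<subseteq> G" "G \<subseteq> I" for G
    proof -
      have "dist (sum f G) (sum f F) = norm (sum f (G - F))"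
        using G by (simp add: dist_norm sum_diff)
      also have "\<dots> \<le> (\<Sum>i\<in>G - F. norm (f i))"
        by (rule norm_sum)
      also have "\<dots> = (\<Sum>i\<in>G. norm (f i)) - (\<Sum>i\<in>F. norm (f i))"
        using G by (simp add: sum_diff)
      also have "\<dots> < \<epsilon> / 2"
        using finite_sum_le_infsum[OF assms, of G] G exhaust by simp
      finally show ?thesis .
    qed
    have "\<forall>\<^sub>F G in ?fin. finite G \<and> F \<subseteq> G \<and> G \<subseteq> I"
      using F unfolding eventually_finite_subsets_at_top by blast
    moreover have "dist (sum f G) (sum f H) < \<epsilon>"
      if "finite G \<and> F \<subseteq> G \<and> G \<subseteq> I" "finite H \<and> F \<subseteq> H \<and> H \<subseteq> I" for G H
      by (rule dist_triangle_half_l[OF close close]) (use that in simp_all)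
    ultimately show ?thesis
      by (intro exI[of _ "\<lambda>G. finite G \<and> F \<subseteq> G \<and> G \<subseteq> I"] conjI allI impI) simp_all
  qed
  then have "cauchy_filter (filtermap (sum f) ?fin)"
    unfolding cauchy_filter_metric_filtermap by blast
  then obtain x where "filtermap (sum f) ?fin \<le> nhds x"
    using cauchy_filter_complete_converges[of "filtermap (sum f) ?fin" UNIV] complete_UNIV
    by (auto simp: filtermap_bot_iff)
  then show ?thesis
    unfolding summable_on_def has_sum_def filterlim_def by blast
qed

lemma powser_sums_zero_scaleR:
  fixes b :: "nat \<Rightarrow> 'a::real_normed_vector"
  shows "(\<lambda>n. (0::real) ^ n *\<^sub>R b n) sums b 0"
  using sums_finite[of "{0}" "\<lambda>n. (0::real) ^ n *\<^sub>R b n"] by simp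

text \<open>
  In \<open>\<Sum>k. (s + h) ^ k b\<^sub>k\<close> expand each power by the binomial theorem.  The sum of the norms of all
  the terms is \<open>\<Sum>k. (\<bar>s\<bar> + \<bar>h\<bar>) ^ k \<parallel>b\<^sub>k\<parallel>\<close>, and if that is finite, the terms may be summed in
  either order.  For \<open>n > k\<close> the binomial coefficient vanishes, so the truncated difference \<open>k - n\<close>
  does no harm and the index set can be taken to be a full product.
\<close>

lemma binomial_double_series_summable:
  fixes b :: "nat \<Rightarrow> 'a::{real_normed_vector, complete_space}" and s h :: real
  assumes "summable (\<lambda>k. norm (b k) * (\<bar>s\<bar> + \<bar>h\<bar>) ^ k)"
  shows "(\<lambda>(k, n). h ^ n *\<^sub>R ((real (k choose n) * s ^ (k - n)) *\<^sub>R b k)) summable_on (UNIV \<times> UNIV)"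
    and "(\<lambda>k. h ^ n *\<^sub>R ((real (k choose n) * s ^ (k - n)) *\<^sub>R b k)) summable_on UNIV"
proof -
  let ?F = "\<lambda>(k, n). h ^ n *\<^sub>R ((real (k choose n) * s ^ (k - n)) *\<^sub>R b k)"
  have row: "((\<lambda>n. norm (?F (k, n))) has_sum norm (b k) * (\<bar>s\<bar> + \<bar>h\<bar>) ^ k) UNIV" for k
  proof (rule has_sum_finite_neutralI)
    show "norm (b k) * (\<bar>s\<bar> + \<bar>h\<bar>) ^ k = (\<Sum>n\<in>{..k}. norm (?F (k, n)))"
      by (subst add.commute, subst binomial_ring)
         (simp add: sum_distrib_left abs_mult power_abs mult_ac)
  qed auto
  have rows: "(\<lambda>k. norm (b k) * (\<bar>s\<bar> + \<bar>h\<bar>) ^ k) summable_on UNIV"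
    using assms by (subst summable_on_UNIV_nonneg_real_iff) auto
  have norms: "(\<lambda>p. norm (?F p)) summable_on (UNIV \<times> UNIV)"
    unfolding Infinite_Sum.abs_summable_on_Sigma_iff
  proof (intro conjI ballI)
    show "(\<lambda>n. norm (?F (k, n))) summable_on UNIV" for k
      using row[of k] by (rule has_sum_imp_summable)
    show "(\<lambda>k. norm (\<Sum>\<^sub>\<infinity>n. norm (?F (k, n)))) summable_on UNIV"
      unfolding infsumI[OF row] using rows by simp
  qed
  then show "?F summable_on (UNIV \<times> UNIV)"
    by (rule summable_on_if_norm_summable_on)
  have inj: "inj (\<lambda>k::nat. (k, n))"
    by (simp add: inj_on_def)
  have "(\<lambda>p. norm (?F p)) summable_on ((\<lambda>k. (k, n)) ` UNIV)"
    using norms by (rule summable_on_subset_banach) auto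
  then have "(\<lambda>k. norm (h ^ n *\<^sub>R ((real (k choose n) * s ^ (k - n)) *\<^sub>R b k))) summable_on UNIV"
    unfolding summable_on_reindex[OF inj] o_def prod.case .
  then show "(\<lambda>k. h ^ n *\<^sub>R ((real (k choose n) * s ^ (k - n)) *\<^sub>R b k)) summable_on UNIV"
    by (rule summable_on_if_norm_summable_on)
qed

text \<open>
  Where \<open>f t = (\<Sum>k. t ^ k b\<^sub>k)\<close> converges absolutely near \<open>s\<close>, this is the Taylor coefficient of
  \<open>f\<close> at \<open>s\<close>, the \<open>n\<close>-th derivative divided by \<open>n!\<close>.
\<close>

definition recentred_coeff :: "(nat \<Rightarrow> 'a::real_normed_vector) \<Rightarrow> real \<Rightarrow> nat \<Rightarrow> 'a" where
  "recentred_coeff b s n = (\<Sum>\<^sub>\<infinity>k. (real (k choose n) * s ^ (k - n)) *\<^sub>R b k)"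

lemma power_series_recentre:
  fixes b :: "nat \<Rightarrow> 'a::{real_normed_vector, complete_space}" and s h :: real
  assumes "summable (\<lambda>k. norm (b k) * (\<bar>s\<bar> + \<bar>h\<bar>) ^ k)"
  shows "(\<lambda>n. h ^ n *\<^sub>R recentred_coeff b s n) sums (\<Sum>\<^sub>\<infinity>k. (s + h) ^ k *\<^sub>R b k)"
proof -
  let ?F = "\<lambda>k n. h ^ n *\<^sub>R ((real (k choose n) * s ^ (k - n)) *\<^sub>R b k)"
  obtain S where S: "((\<lambda>(k, n). ?F k n) has_sum S) (UNIV \<times> UNIV)"
    using binomial_double_series_summable(1)[OF assms] unfolding summable_on_def by blast
  have row: "(?F k has_sum (s + h) ^ k *\<^sub>R b k) UNIV" for k
  proof (rule has_sum_finite_neutralI)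
    show "(s + h) ^ k *\<^sub>R b k = (\<Sum>n\<in>{..k}. ?F k n)"
      by (subst add.commute, subst binomial_ring) (simp add: scaleR_left.sum mult_ac)
  qed auto
  have column: "((\<lambda>k. ?F k n) has_sum h ^ n *\<^sub>R recentred_coeff b s n) UNIV" for n
    using has_sum_infsum[OF binomial_double_series_summable(2)[OF assms, of n]]
    by (simp only: infsum_scaleR_right recentred_coeff_def)
  have "((\<lambda>k. (s + h) ^ k *\<^sub>R b k) has_sum S) UNIV"
    by (rule has_sum_SigmaD[OF S]) (simp only: prod.case row)
  then have "(\<Sum>\<^sub>\<infinity>k. (s + h) ^ k *\<^sub>R b k) = S"
    by (rule infsumI)
  moreover have "((\<lambda>(n, k). ?F k n) has_sum S) (UNIV \<times> UNIV)"
    using S has_sum_swap[where f = "\<lambda>(k, n). ?F k n" and A = UNIV and B = UNIV] by (simp only: prod.case)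
  then have "((\<lambda>n. h ^ n *\<^sub>R recentred_coeff b s n) has_sum S) UNIV"
    by (rule has_sum_SigmaD) (simp only: prod.case column)
  ultimately show ?thesis
    by (simp only: has_sum_imp_sums)
qed

text \<open>
  The linear coefficient around \<open>s\<close> is the series differentiated term by term.  Its convergence is that
  of the column \<open>n = 1\<close> of the double series.
\<close>

lemma recentred_coeff_1_sums:
  fixes b :: "nat \<Rightarrow> 'a::{real_normed_vector, complete_space}" and s R :: real
  assumes "\<bar>s\<bar> < R" and "\<And>r. 0 \<le> r \<Longrightarrow> r < R \<Longrightarrow> summable (\<lambda>k. norm (b k) * r ^ k)"
  shows "(\<lambda>k. (real k * s ^ (k - 1)) *\<^sub>R b k) sums recentred_coeff b s 1"
proof -
  \<comment> \<open>Any positive increment inside the disc would do: it is divided out of the column again.\<close>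
  define h where "h = (R - \<bar>s\<bar>) / 2"
  have h: "h > 0" "\<bar>s\<bar> + \<bar>h\<bar> < R"
    using assms(1) by (auto simp: h_def field_simps)
  have "(\<lambda>k. h *\<^sub>R ((real k * s ^ (k - 1)) *\<^sub>R b k)) summable_on UNIV"
    using binomial_double_series_summable(2)[OF assms(2)[of "\<bar>s\<bar> + \<bar>h\<bar>"], where n = 1] h by simp
  then have "(\<lambda>k. inverse h *\<^sub>R (h *\<^sub>R ((real k * s ^ (k - 1)) *\<^sub>R b k))) summable_on UNIV"
    by (rule summable_on_scaleR_right)
  moreover have "inverse h *\<^sub>R (h *\<^sub>R v) = v" for v :: 'a
    using h by simp
  ultimately have "(\<lambda>k. (real k * s ^ (k - 1)) *\<^sub>R b k) summable_on UNIV"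
    by (simp only:)
  then have "(\<lambda>k. (real k * s ^ (k - 1)) *\<^sub>R b k) sums
      (\<Sum>\<^sub>\<infinity>k. (real k * s ^ (k - 1)) *\<^sub>R b k)"
    by (intro has_sum_imp_sums has_sum_infsum)
  then show ?thesis
    by (simp add: recentred_coeff_def)
qed

lemma real_analytic_on_power_series:
  fixes b :: "nat \<Rightarrow> 'a::{real_normed_vector, complete_space}" and R :: real
  assumes "\<And>r. 0 \<le> r \<Longrightarrow> r < R \<Longrightarrow> summable (\<lambda>k. norm (b k) * r ^ k)"
  shows "real_analytic_on (\<lambda>t. \<Sum>\<^sub>\<infinity>k. t ^ k *\<^sub>R b k) {t. \<bar>t\<bar> < R}"
  unfolding real_analytic_on_def
proof
  fix s assume "s \<in> {t. \<bar>t\<bar> < R}"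
  moreover have "(\<lambda>n. (t - s) ^ n *\<^sub>R recentred_coeff b s n) sums (\<Sum>\<^sub>\<infinity>k. t ^ k *\<^sub>R b k)"
    if "\<bar>t - s\<bar> < R - \<bar>s\<bar>" for t
    using power_series_recentre[OF assms[of "\<bar>s\<bar> + \<bar>t - s\<bar>"]] that by simp
  ultimately show "\<exists>r>0. \<exists>c. \<forall>t. \<bar>t - s\<bar> < r \<longrightarrow>
      (\<lambda>n. (t - s) ^ n *\<^sub>R c n) sums (\<Sum>\<^sub>\<infinity>k. t ^ k *\<^sub>R b k)"
    by (intro exI[of _ "R - \<bar>s\<bar>"] conjI exI[of _ "recentred_coeff b s"]) auto
qed

text \<open>
  Convergence at distance \<open>\<rho> = r / 2\<close> bounds the coefficients by \<open>M / \<rho> ^ n\<close>.  For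
  \<open>\<bar>t - s\<bar> \<le> \<rho> / 2\<close> the terms from the quadratic one on are therefore dominated by
  \<open>(t - s)\<^sup>2 M / \<rho>\<^sup>2\<close> times a geometric series of ratio \<open>1 / 2\<close>.
\<close>

lemma power_series_has_vector_derivative:
  fixes b :: "nat \<Rightarrow> 'a::real_normed_vector" and s r :: real
  assumes "r > 0" and sums: "\<And>t. \<bar>t - s\<bar> < r \<Longrightarrow> (\<lambda>n. (t - s) ^ n *\<^sub>R b n) sums f t"
  shows "(f has_vector_derivative b 1) (at s)"
proof -
  define \<rho> where "\<rho> = r / 2"
  have \<rho>: "\<rho> > 0" "\<rho> < r"
    using assms(1) by (auto simp: \<rho>_def)
  have "summable (\<lambda>n. \<rho> ^ n *\<^sub>R b n)"
    using sums[of "s + \<rho>"] \<rho> by (auto simp: sums_iff)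
  then have "Bseq (\<lambda>n. \<rho> ^ n *\<^sub>R b n)"
    by (intro convergent_imp_Bseq summable_LIMSEQ_zero[THEN convergentI])
  then obtain M where M: "M > 0" "\<And>n. norm (\<rho> ^ n *\<^sub>R b n) \<le> M"
    unfolding Bseq_def by blast
  define K where "K = 2 * M / \<rho>\<^sup>2"
  have "K > 0"
    using M \<rho> by (simp add: K_def)
  have remainder: "norm (f t - f s - (t - s) *\<^sub>R b 1) \<le> K * (t - s)\<^sup>2" if t: "\<bar>t - s\<bar> \<le> \<rho> / 2" for t
  proof -
    have "f s = b 0"
      using sums[of s] powser_sums_zero_scaleR assms(1) by (auto intro: sums_unique2)
    moreover have "(\<lambda>n. (t - s) ^ (n + 2) *\<^sub>R b (n + 2)) sums
        (f t - (\<Sum>n<2. (t - s) ^ n *\<^sub>R b n))"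
      using sums[of t] t \<rho> by (intro sums_split_initial_segment) auto
    ultimately have tail: "(\<lambda>n. (t - s) ^ (n + 2) *\<^sub>R b (n + 2)) sums (f t - f s - (t - s) *\<^sub>R b 1)"
      by (simp add: numeral_2_eq_2 algebra_simps)
    have "norm ((t - s) ^ (n + 2) *\<^sub>R b (n + 2)) \<le> (t - s)\<^sup>2 * M / \<rho>\<^sup>2 * (1 / 2) ^ n" for n
    proof -
      have "norm (b (n + 2)) \<le> M / \<rho> ^ (n + 2)"
        using M(2)[of "n + 2"] \<rho> by (simp add: field_simps)
      moreover have "\<bar>t - s\<bar> ^ n \<le> (\<rho> / 2) ^ n"
        using t by (intro power_mono) auto
      ultimately have "\<bar>t - s\<bar> ^ n * norm (b (n + 2)) \<le> (\<rho> / 2) ^ n * (M / \<rho> ^ (n + 2))"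
        using \<rho> by (intro mult_mono) auto
      also have "\<dots> = M / \<rho>\<^sup>2 * (1 / 2) ^ n"
        using \<rho> by (simp add: power_add power_divide power2_eq_square)
      finally have "(t - s)\<^sup>2 * (\<bar>t - s\<bar> ^ n * norm (b (n + 2))) \<le> (t - s)\<^sup>2 * (M / \<rho>\<^sup>2 * (1 / 2) ^ n)"
        by (rule mult_left_mono) simp
      then show ?thesis
        by (simp add: power_add power_abs abs_mult power2_eq_square mult_ac)
    qed
    moreover have "(\<lambda>n. (t - s)\<^sup>2 * M / \<rho>\<^sup>2 * (1 / 2) ^ n) sums ((t - s)\<^sup>2 * M / \<rho>\<^sup>2 * 2)"
      using geometric_sums[of "1 / 2 :: real"] by (intro sums_mult) simp
    ultimately have "norm (f t - f s - (t - s) *\<^sub>R b 1) \<le> (t - s)\<^sup>2 * M / \<rho>\<^sup>2 * 2"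
      using tail unfolding sums_def
      by (intro LIMSEQ_le[OF tendsto_norm]) (auto intro!: sum_norm_le)
    then show ?thesis
      by (simp add: K_def mult_ac)
  qed
  show ?thesis
    unfolding has_vector_derivative_def has_derivative_at'
  proof (intro conjI allI impI bounded_linear_scaleR_left)
    fix \<epsilon> :: real assume "\<epsilon> > 0"
    have cancel: "K * u\<^sup>2 / u = K * u" for u
      by (simp add: power2_eq_square)
    have "norm (f t - f s - (t - s) *\<^sub>R b 1) / norm (t - s) < \<epsilon>"
      if "0 < norm (t - s)" "norm (t - s) < min (\<rho> / 2) (\<epsilon> / K)" for t
    proof -
      have "norm (f t - f s - (t - s) *\<^sub>R b 1) / norm (t - s) \<le> K * (t - s)\<^sup>2 / norm (t - s)"
        using remainder[of t] that by (intro divide_right_mono) auto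
      also have "\<dots> = K * norm (t - s)"
        using cancel[of "norm (t - s)"] by simp
      also have "\<dots> < \<epsilon>"
        using that \<open>K > 0\<close> by (simp add: field_simps)
      finally show ?thesis .
    qed
    then show "\<exists>d>0. \<forall>t. 0 < norm (t - s) \<and> norm (t - s) < d \<longrightarrow>
        norm (f t - f s - (t - s) *\<^sub>R b 1) / norm (t - s) < \<epsilon>"
      using \<open>\<epsilon> > 0\<close> \<open>K > 0\<close> \<rho> by (intro exI[of _ "min (\<rho> / 2) (\<epsilon> / K)"]) auto
  qed
qed

text \<open>
  Once all coefficients before \<open>b\<^sub>m\<close> are known to vanish, divide by \<open>t ^ m\<close>: the quotient is again
  a power series, has the value \<open>b\<^sub>m\<close> at \<open>0\<close> and vanishes for \<open>t \<noteq> 0\<close>.  Being differentiable at \<open>0\<close>,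
  it is continuous there, so \<open>b\<^sub>m = 0\<close>.
\<close>

lemma power_series_identity:
  fixes b :: "nat \<Rightarrow> 'a::real_normed_vector" and R :: real
  assumes "R > 0" and zero: "\<And>t. \<bar>t\<bar> < R \<Longrightarrow> (\<lambda>n. t ^ n *\<^sub>R b n) sums 0"
  shows "b n = 0"
proof (induction n rule: less_induct)
  case (less m)
  define g where "g t = (if t = 0 then b m else 0)" for t :: real
  have "(\<lambda>n. t ^ n *\<^sub>R b (n + m)) sums g t" if t: "\<bar>t\<bar> < R" for t
  proof (cases "t = 0")
    case True
    then show ?thesis
      using powser_sums_zero_scaleR[of "\<lambda>n. b (n + m)"] by (simp add: g_def)
  next
    case False
    have "(\<lambda>n. t ^ (n + m) *\<^sub>R b (n + m)) sums (0 - (\<Sum>n<m. t ^ n *\<^sub>R b n))"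
      using zero[OF t] by (rule sums_split_initial_segment)
    then have "(\<lambda>n. inverse (t ^ m) *\<^sub>R (t ^ (n + m) *\<^sub>R b (n + m))) sums
        (inverse (t ^ m) *\<^sub>R (0 :: 'a))"
      using less by (intro sums_scaleR_right) simp
    then show ?thesis
      using False by (simp add: power_add g_def mult.left_commute)
  qed
  then have "(g has_vector_derivative b (1 + m)) (at 0)"
    using power_series_has_vector_derivative[of R 0 "\<lambda>n. b (n + m)" g] assms(1) by simp
  then have "g \<midarrow>0\<rightarrow> g 0"
    using has_vector_derivative_continuous isContD by blast
  moreover have "g \<midarrow>0\<rightarrow> 0"
    by (rule Lim_transform_eventually[OF tendsto_const])
       (auto simp: g_def eventually_at_filter)
  ultimately have "g 0 = 0"
    by (rule LIM_unique)
  then show ?case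
    by (simp add: g_def)
qed

section \<open>Closed operators and convergent series\<close>

text \<open>
  Closedness stands in for boundedness: \<open>A\<close> may be applied term by term, provided that the series of
  the images converges as well, because the pairs of partial sums stay on the closed graph.
\<close>

lemma closed_operator_sums:
  fixes A :: "'x::real_normed_vector \<Rightarrow> 'y::real_normed_vector"
  assumes "linear_operator_on D A" and "closed_operator D A"
    and "\<And>k. u k \<in> D" and "u sums x" and "(\<lambda>k. A (u k)) sums y"
  shows "x \<in> D" and "A x = y"
proof -
  have D: "subspace D" and add: "\<And>v w. v \<in> D \<Longrightarrow> w \<in> D \<Longrightarrow> A (v + w) = A v + A w"
    and scale: "\<And>r v. v \<in> D \<Longrightarrow> A (r *\<^sub>R v) = r *\<^sub>R A v"
    using assms(1) by (auto simp: linear_operator_on_def)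
  have in_D: "(\<Sum>k<n. u k) \<in> D" for n
    using D assms(3) by (intro subspace_sum)
  have A_sum: "A (\<Sum>k<n. u k) = (\<Sum>k<n. A (u k))" for n
  proof (induction n)
    case 0
    show ?case
      using scale[of 0 0] subspace_0[OF D] by simp
  next
    case (Suc n)
    then show ?case
      by (simp add: add in_D assms(3))
  qed
  have "(x, y) \<in> {(v, A v) | v. v \<in> D}"
  proof (rule closed_sequentially)
    show "closed {(v, A v) | v. v \<in> D}"
      using assms(2) by (simp add: closed_operator_def)
    show "(\<Sum>k<n. u k, \<Sum>k<n. A (u k)) \<in> {(v, A v) | v. v \<in> D}" for n
      using in_D A_sum by force
    show "(\<lambda>n. (\<Sum>k<n. u k, \<Sum>k<n. A (u k))) \<longlonglongrightarrow> (x, y)"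
      using assms(4,5) unfolding sums_def by (rule tendsto_Pair)
  qed
  then show "x \<in> D" and "A x = y"
    by auto
qed

section \<open>The radius of convergence\<close>

text \<open>The left-hand side is the single term of index \<open>k\<close> in the exponential series of \<open>e ^ k\<close>.\<close>

lemma self_power_div_fact_le_exp_power: "real k ^ k / fact k \<le> exp 1 ^ k"
proof -
  have "(\<lambda>n. real k ^ n / fact n) sums exp (real k)"
    using exp_converges[of "real k"] by (simp add: divide_inverse mult_ac)
  then have "sum (\<lambda>n. real k ^ n / fact n) {k} \<le> exp (real k)"
    unfolding sums_iff by (metis (no_types, lifting) sum_le_suminf finite.intros
        of_nat_0_le_iff zero_le_power fact_ge_zero divide_nonneg_nonneg)
  then show ?thesis
    by (simp add: exp_of_nat_mult[of k 1, simplified])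
qed

lemma summable_egf_if_self_power_bound:
  fixes a :: "nat \<Rightarrow> 'a::real_normed_vector" and c r :: real
  assumes "c > 0" and "\<forall>\<^sub>F k in sequentially. norm (a k) \<le> (real k / c) ^ k"
    and "0 \<le> r" "r < c / exp 1"
  shows "summable (\<lambda>k. norm (a k) / fact k * r ^ k)"
proof (rule summable_comparison_test_ev)
  show "summable (\<lambda>k. (r * exp 1 / c) ^ k)"
    using assms by (intro summable_geometric) (simp add: field_simps)
  show "\<forall>\<^sub>F k in sequentially. norm (norm (a k) / fact k * r ^ k) \<le> (r * exp 1 / c) ^ k"
    using assms(2)
  proof eventually_elim
    case (elim k)
    have "norm (a k) / fact k * r ^ k \<le> (real k / c) ^ k / fact k * r ^ k"
      using elim assms by (intro mult_right_mono divide_right_mono) auto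
    also have "\<dots> = real k ^ k / fact k * (r / c) ^ k"
      by (simp add: power_divide)
    also have "\<dots> \<le> exp 1 ^ k * (r / c) ^ k"
      using assms by (intro mult_right_mono self_power_div_fact_le_exp_power) auto
    also have "\<dots> = (r * exp 1 / c) ^ k"
      by (simp add: power_divide power_mult_distrib)
    finally show ?case
      using assms by simp
  qed
qed

section \<open>The solution of the Cauchy problem\<close>

theorem theorem35:
  fixes E :: "'x::{real_inner, complete_space} \<Rightarrow> 'y::{real_inner, complete_space}"
    and A :: "'x \<Rightarrow> 'y"
    and D :: "'x set"
    and a :: "nat \<Rightarrow> 'x"
    and c :: real
  assumes "bounded_linear E"
    and "linear_operator_on D A"
    and "closed_operator D A"
    and "densely_defined D"
    and "\<And>k. k \<ge> 1 \<Longrightarrow> a k \<in> D"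
    and "\<exists>k\<ge>1. a k \<noteq> 0"
    and "E (a 1) = 0"
    and "\<And>k. k \<ge> 1 \<Longrightarrow> E (a (k + 1)) = A (a k)"
    and "c > 0"
    and "\<forall>\<^sub>F k in sequentially.
           norm (a k) \<le> (real k / c) ^ k \<and>
           norm (A (a k)) \<le> (real k / c) ^ k \<and>
           norm (E (a k)) \<le> (real k / c) ^ k"
  shows "\<exists>(f :: real \<Rightarrow> 'x) f'.
           real_analytic_on f {t. \<bar>t\<bar> < c / exp 1} \<and>
           (\<exists>t. \<bar>t\<bar> < c / exp 1 \<and> f t \<noteq> 0) \<and>
           (\<forall>t. \<bar>t\<bar> < c / exp 1 \<longrightarrow>
              (f has_vector_derivative f' t) (at t) \<and> f t \<in> D \<and> E (f' t) = A (f t)) \<and>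
           f 0 = 0"
proof -
  note E = assms(1) and A = assms(2,3) and a_in_D = assms(5) and c = assms(9)
  define R where "R = c / exp 1"
  have "R > 0"
    using c by (simp add: R_def)
  \<comment> \<open>The chain starts at index 1, so the value of \<open>a\<close> at 0 is replaced by the constant term 0.\<close>
  define b where "b k = (if k = 0 then 0 else inverse (fact k) *\<^sub>R a k)" for k
  define f where "f t = (\<Sum>\<^sub>\<infinity>k. t ^ k *\<^sub>R b k)" for t :: real
  define f' where "f' t = recentred_coeff b t 1" for t :: real

  have bound_a: "\<forall>\<^sub>F k in sequentially. norm (a k) \<le> (real k / c) ^ k"
    using assms(10) by eventually_elim simp
  have summable_b: "summable (\<lambda>k. norm (b k) * r ^ k)" if "0 \<le> r" "r < R" for r
  proof (rule summable_comparison_test'[where N = 0])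
    show "summable (\<lambda>k. norm (a k) / fact k * r ^ k)"
      using summable_egf_if_self_power_bound[OF c bound_a] that by (simp add: R_def)
    show "norm (norm (b k) * r ^ k) \<le> norm (a k) / fact k * r ^ k" for k
      using that by (simp add: b_def divide_inverse mult_ac)
  qed

  have f_sums: "(\<lambda>k. t ^ k *\<^sub>R b k) sums f t" if "\<bar>t\<bar> < R" for t
  proof -
    have "(\<lambda>k. t ^ k *\<^sub>R b k) summable_on UNIV"
      by (rule summable_on_if_norm_summable_on)
        (use summable_b[of "\<bar>t\<bar>"] that in \<open>simp add: summable_on_UNIV_nonneg_real_iff power_abs mult_ac\<close>)
    then show ?thesis
      unfolding f_def by (intro has_sum_imp_sums has_sum_infsum)
  qed
  have analytic: "real_analytic_on f {t. \<bar>t\<bar> < R}"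
    unfolding f_def using summable_b by (rule real_analytic_on_power_series)
  have derivative: "(f has_vector_derivative f' t) (at t)" if t: "\<bar>t\<bar> < R" for t
    unfolding f'_def
  proof (rule power_series_has_vector_derivative)
    show "0 < R - \<bar>t\<bar>"
      using t by simp
    show "(\<lambda>n. (u - t) ^ n *\<^sub>R recentred_coeff b t n) sums f u" if "\<bar>u - t\<bar> < R - \<bar>t\<bar>" for u
      using power_series_recentre[OF summable_b[of "\<bar>t\<bar> + \<bar>u - t\<bar>"]] that by (simp add: f_def)
  qed

  have equation: "f t \<in> D \<and> E (f' t) = A (f t)" if t: "\<bar>t\<bar> < R" for t
  proof -
    have in_D: "t ^ k *\<^sub>R b k \<in> D" for k
      using A(1) a_in_D[of k] unfolding linear_operator_on_def b_def
      by (auto intro: subspace_scale subspace_0)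
    have "A 0 = 0"
      using A(1) subspace_0 unfolding linear_operator_on_def by (metis scaleR_zero_left)
    have chain: "E ((real (Suc k) * t ^ k) *\<^sub>R b (Suc k)) = A (t ^ k *\<^sub>R b k)" for k
    proof (cases "k = 0")
      case True
      then show ?thesis
        using assms(7) \<open>A 0 = 0\<close> by (simp add: b_def)
    next
      case False
      have "E ((real (Suc k) * t ^ k) *\<^sub>R b (Suc k)) = (t ^ k * inverse (fact k)) *\<^sub>R E (a (Suc k))"
        by (simp add: b_def linear_cmul[OF bounded_linear.linear[OF E]] field_simps del: of_nat_Suc)
      also have "E (a (Suc k)) = A (a k)"
        using assms(8)[of k] False by simp
      also have "(t ^ k * inverse (fact k)) *\<^sub>R A (a k) = A (t ^ k *\<^sub>R b k)"
        using A(1) a_in_D[of k] False by (simp add: b_def linear_operator_on_def)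
      finally show ?thesis .
    qed
    have "(\<lambda>k. (real k * t ^ (k - 1)) *\<^sub>R b k) sums f' t"
      unfolding f'_def using t summable_b by (rule recentred_coeff_1_sums)
    then have "(\<lambda>k. (real (Suc k) * t ^ k) *\<^sub>R b (Suc k)) sums f' t"
      using sums_Suc_iff[of "\<lambda>k. (real k * t ^ (k - 1)) *\<^sub>R b k" "f' t"] by simp
    then have "(\<lambda>k. E ((real (Suc k) * t ^ k) *\<^sub>R b (Suc k))) sums E (f' t)"
      by (rule bounded_linear.sums[OF E])
    then have "(\<lambda>k. A (t ^ k *\<^sub>R b k)) sums E (f' t)"
      by (simp only: chain)
    then show ?thesis
      using closed_operator_sums[OF A in_D f_sums[OF t]] by simp
  qed

  have "\<exists>t. \<bar>t\<bar> < R \<and> f t \<noteq> 0"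
  proof (rule ccontr)
    assume "\<not> ?thesis"
    then have "(\<lambda>k. t ^ k *\<^sub>R b k) sums 0" if "\<bar>t\<bar> < R" for t
      using f_sums[OF that] that by auto
    then have "b k = 0" for k
      by (rule power_series_identity[OF \<open>R > 0\<close>])
    then have "a k = 0" if "k \<ge> 1" for k
      using that by (auto simp: b_def split: if_splits dest!: meta_spec[of _ k])
    then show False
      using assms(6) by blast
  qed
  moreover have "f 0 = 0"
    using f_sums[of 0] powser_sums_zero_scaleR[of b] \<open>R > 0\<close>
    by (auto simp: b_def intro: sums_unique2)
  ultimately show ?thesis
    using analytic derivative equation unfolding R_def by blast
qed

end
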